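(* For all formulas $A,B$ of the language of interpretability logic the following hold. (i) $\mathbf{IL}\mathsf{M}\vdash\Box A$ if and only if $\mathbf{IL}\mathsf{M}\vdash A$. (ii) $\mathbf{IL}\mathsf{M}\vdash\Box A\vee\Box B$ if and only if $\mathbf{IL}\mathsf{M}\vdash\Box A$ or $\mathbf{IL}\mathsf{M}\vdash\Box B$. (iii) $\mathbf{IL}\mathsf{M}\vdash A\rhd B$ if and only if $\mathbf{IL}\mathsf{M}\vdash A\rightarrow B\vee\Diamond B$. (iv) $\mathbf{IL}\mathsf{M}\vdash A\rhd B$ if and only if $\mathbf{IL}\mathsf{M}\vdash\Diamond A\rightarrow\Diamond B$. (v) If $(A_i)_i$ is a finite family of formulas such that $\mathbf{IL}\mathsf{M}\nvdash\neg A_i$ for every $i$, then $\mathbf{IL}\mathsf{M}\vdash\bigwedge_i\Diamond A_i\rightarrow A\rhd B$ if and only if $\mathbf{IL}\mathsf{M}\vdash A\rhd B$. (vi) $\mathbf{IL}\mathsf{M}\vdash A\vee\Diamond A$ if and only if $\mathbf{IL}\mathsf{M}\vdash\Box\bot\rightarrow A$. (vii) $\mathbf{IL}\mathsf{M}\vdash\top\rhd A$ if and only if $\mathbf{IL}\mathsf{M}\vdash\Box\bot\rightarrow A$.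
   Context: Formulas are built from $\bot$ and a countable set $\mathsf{Prop}$ of propositional variables using the binary connective $\rightarrow$, the unary modality $\Box$ and the binary modality $\rhd$; $\neg,\wedge,\vee,\leftrightarrow,\top$ are defined as usual and $\Diamond A:=\neg\Box\neg A$. Here $\rhd$ binds more weakly than $\neg,\Box,\Diamond,\wedge,\vee$ and more strongly than $\rightarrow$. The logic $\mathbf{IL}$ is the smallest set of formulas closed under Necessitation and Modus Ponens that contains all propositional tautologies and all instances of: L1 $\Box(A\rightarrow B)\rightarrow(\Box A\rightarrow\Box B)$; L2 $\Box A\rightarrow\Box\Box A$; L3 $\Box(\Box A\rightarrow A)\rightarrow\Box A$; J1 $\Box(A\rightarrow B)\rightarrow A\rhd B$; J2 $(A\rhd B)\wedge(B\rhd C)\rightarrow A\rhd C$; J3 $(A\rhd C)\wedge(B\rhd C)\rightarrow A\vee B\rhd C$; J4 $A\rhd B\rightarrow(\Diamond A\rightarrow\Diamond B)$; J5 $\Diamond A\rhd A$. $\mathbf{IL}\mathsf{M}$ is obtained by adding the axiom schema M: $A\rhd B\rightarrow A\wedge\Box C\rhd B\wedge\Box C$. $\mathbf{IL}\mathsf{M}\vdash\varphi$ means $\varphi\in\mathbf{IL}\mathsf{M}$. *)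

theory Defs
  imports Main "HOL-Library.Countable"
begin

datatype 'p form =
    Var 'p
  | Bot  ("\<^bold>\<bottom>")
  | Imp "'p form" "'p form"  (infixr "\<^bold>\<rightarrow>" 60)
  | Box "'p form"  ("\<box> _" [80] 80)
  | Rhd "'p form" "'p form"  (infix "\<rhd>" 65)

abbreviation Neg :: "'p form \<Rightarrow> 'p form"  ("\<^bold>\<not> _" [80] 80)
  where "\<^bold>\<not> A \<equiv> A \<^bold>\<rightarrow> \<^bold>\<bottom>"

abbreviation Top :: "'p form"  ("\<^bold>\<top>")
  where "\<^bold>\<top> \<equiv> \<^bold>\<not> \<^bold>\<bottom>"

abbreviation Or :: "'p form \<Rightarrow> 'p form \<Rightarrow> 'p form"  (infixr "\<^bold>\<or>" 70)
  where "A \<^bold>\<or> B \<equiv> \<^bold>\<not> A \<^bold>\<rightarrow> B"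

abbreviation And :: "'p form \<Rightarrow> 'p form \<Rightarrow> 'p form"  (infixr "\<^bold>\<and>" 75)
  where "A \<^bold>\<and> B \<equiv> \<^bold>\<not> (A \<^bold>\<rightarrow> \<^bold>\<not> B)"

abbreviation Dia :: "'p form \<Rightarrow> 'p form"  ("\<diamond> _" [80] 80)
  where "\<diamond> A \<equiv> \<^bold>\<not> \<box> \<^bold>\<not> A"

primrec Conj :: "'p form list \<Rightarrow> 'p form"
  where
    "Conj [] = \<^bold>\<top>"
  | "Conj (A # As) = A \<^bold>\<and> Conj As"

text \<open>
  For propositional tautologies, formulas whose outermost symbol is a modality are treated
  as atoms, so a valuation assigns truth values to them as well as to the variables
  (its values on \<open>\<^bold>\<bottom>\<close> and on implications are ignored).
\<close>

primrec prop_eval :: "('p form \<Rightarrow> bool) \<Rightarrow> 'p form \<Rightarrow> bool"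
  where
    "prop_eval v (Var p) \<longleftrightarrow> v (Var p)"
  | "prop_eval v \<^bold>\<bottom> \<longleftrightarrow> False"
  | "prop_eval v (A \<^bold>\<rightarrow> B) \<longleftrightarrow> (prop_eval v A \<longrightarrow> prop_eval v B)"
  | "prop_eval v (\<box> A) \<longleftrightarrow> v (\<box> A)"
  | "prop_eval v (A \<rhd> B) \<longleftrightarrow> v (A \<rhd> B)"

definition tautology :: "'p form \<Rightarrow> bool"
  where "tautology A \<longleftrightarrow> (\<forall>v. prop_eval v A)"

text \<open>The extension of the logic IL by a set \<open>X\<close> of additional axioms; IL itself is \<open>ILX {}\<close>.\<close>

inductive_set ILX :: "'p form set \<Rightarrow> 'p form set" for X :: "'p form set"
  where
    Taut: "tautology A \<Longrightarrow> A \<in> ILX X"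
  | L1: "\<box> (A \<^bold>\<rightarrow> B) \<^bold>\<rightarrow> (\<box> A \<^bold>\<rightarrow> \<box> B) \<in> ILX X"
  | L2: "\<box> A \<^bold>\<rightarrow> \<box> \<box> A \<in> ILX X"
  | L3: "\<box> (\<box> A \<^bold>\<rightarrow> A) \<^bold>\<rightarrow> \<box> A \<in> ILX X"
  | J1: "\<box> (A \<^bold>\<rightarrow> B) \<^bold>\<rightarrow> A \<rhd> B \<in> ILX X"
  | J2: "(A \<rhd> B) \<^bold>\<and> (B \<rhd> C) \<^bold>\<rightarrow> A \<rhd> C \<in> ILX X"
  | J3: "(A \<rhd> C) \<^bold>\<and> (B \<rhd> C) \<^bold>\<rightarrow> A \<^bold>\<or> B \<rhd> C \<in> ILX X"
  | J4: "A \<rhd> B \<^bold>\<rightarrow> (\<diamond> A \<^bold>\<rightarrow> \<diamond> B) \<in> ILX X"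
  | J5: "\<diamond> A \<rhd> A \<in> ILX X"
  | Extra: "A \<in> X \<Longrightarrow> A \<in> ILX X"
  | MP: "A \<^bold>\<rightarrow> B \<in> ILX X \<Longrightarrow> A \<in> ILX X \<Longrightarrow> B \<in> ILX X"
  | Nec: "A \<in> ILX X \<Longrightarrow> \<box> A \<in> ILX X"

definition M_axioms :: "'p form set"
  where "M_axioms = {A \<rhd> B \<^bold>\<rightarrow> A \<^bold>\<and> \<box> C \<rhd> B \<^bold>\<and> \<box> C | A B C. True}"

definition ILM :: "'p form set"
  where "ILM = ILX M_axioms"

end

theory Submission
  imports Defs
begin

text \<open>
  Behind (i) to (v) and (vii) is one construction. Add to the canonical picture of a logic
  \<open>T\<close> a new root below everything: there \<open>\<box> A\<close> should be true iff \<open>A\<close> holds in all worlds above,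
  which is read as \<open>A \<in> T\<close>, and \<open>A \<rhd> B\<close> should be true iff above the root every \<open>A\<close>-world is a
  \<open>B\<close>-world or sees one, which is read as \<open>A \<^bold>\<rightarrow> B \<^bold>\<or> \<diamond> B \<in> T\<close>. (In a Veltman frame the
  relation that interprets \<open>\<rhd>\<close> at the root must link every world above it to itself and to its
  successors; taking just these links makes the fewest formulas \<open>A \<rhd> B\<close> true.)
  No frame has to be built: the two clauses define a valuation of the modal formulas in terms of membership in \<open>T\<close>, and induction
  on derivations shows that the theorems of \<open>ILM\<close> are true under it
  (\<open>root_soundness\<close>). Necessitation is sound because \<open>T\<close> contains the theorems of \<open>ILM\<close>, and L3
  is sound because \<open>T\<close> is closed under the Loeb rule.

  With \<open>T = ILM\<close> the truth of a theorem at the root gives the hard directions of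
  (i), (ii), (iii) and (v) at once; in (v) each \<open>\<diamond> A\<^sub>i\<close> is true at the root because
  \<open>\<^bold>\<not> A\<^sub>i \<notin> ILM\<close>. For (iv) the new root is put only below the worlds where \<open>B\<close> fails and at
  whose successors \<open>B\<close> fails too: \<open>T\<close> is the set of consequences of \<open>\<^bold>\<not> B \<^bold>\<and> \<box> \<^bold>\<not> B\<close>. At this root
  \<open>\<diamond> B\<close> is false, so \<open>\<diamond> A\<close> is false too, which says that \<open>A \<^bold>\<rightarrow> B \<^bold>\<or> \<diamond> B\<close> is provable, and (iii) applies.
  Finally, (vi) is a direct use of Loeb's axiom, and (vii) combines (iii) and (vi).
\<close>

section \<open>Normal extensions\<close>

definition normal_extension :: "'p form set \<Rightarrow> bool"
  where "normal_extension T \<longleftrightarrow> ILM \<subseteq> T \<and>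
    (\<forall>A B. A \<^bold>\<rightarrow> B \<in> T \<longrightarrow> A \<in> T \<longrightarrow> B \<in> T) \<and> (\<forall>A. A \<in> T \<longrightarrow> \<box> A \<in> T)"

lemma ILM_subset: "normal_extension T \<Longrightarrow> A \<in> ILM \<Longrightarrow> A \<in> T"
  by (auto simp: normal_extension_def)

lemma mp: "normal_extension T \<Longrightarrow> A \<^bold>\<rightarrow> B \<in> T \<Longrightarrow> A \<in> T \<Longrightarrow> B \<in> T"
  unfolding normal_extension_def by blast

lemma nec: "normal_extension T \<Longrightarrow> A \<in> T \<Longrightarrow> \<box> A \<in> T"
  by (simp add: normal_extension_def)

lemma normal_extension_ILM: "normal_extension ILM"
  unfolding normal_extension_def ILM_def by (auto intro: ILX.Nec dest: ILX.MP)

lemma prop_consequence0: "normal_extension T \<Longrightarrow> tautology A \<Longrightarrow> A \<in> T"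
  by (rule ILM_subset) (simp_all add: ILM_def ILX.Taut)

lemma prop_consequence1:
  assumes "normal_extension T" "A \<in> T" "tautology (A \<^bold>\<rightarrow> B)"
  shows "B \<in> T"
  by (rule mp[OF assms(1) prop_consequence0[OF assms(1,3)] assms(2)])

lemma prop_consequence2:
  assumes "normal_extension T" "A \<in> T" "B \<in> T" "tautology (A \<^bold>\<rightarrow> B \<^bold>\<rightarrow> C)"
  shows "C \<in> T"
  by (rule mp[OF assms(1) prop_consequence1[OF assms(1,2,4)] assms(3)])

lemma prop_consequence3:
  assumes "normal_extension T" "A \<in> T" "B \<in> T" "C \<in> T" "tautology (A \<^bold>\<rightarrow> B \<^bold>\<rightarrow> C \<^bold>\<rightarrow> D)"
  shows "D \<in> T"
  by (rule mp[OF assms(1) prop_consequence2[OF assms(1-3,5)] assms(4)])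

lemma axiom_K: "normal_extension T \<Longrightarrow> \<box> (A \<^bold>\<rightarrow> B) \<^bold>\<rightarrow> (\<box> A \<^bold>\<rightarrow> \<box> B) \<in> T"
  by (rule ILM_subset) (simp_all add: ILM_def ILX.L1)

lemma axiom_4: "normal_extension T \<Longrightarrow> \<box> A \<^bold>\<rightarrow> \<box> \<box> A \<in> T"
  by (rule ILM_subset) (simp_all add: ILM_def ILX.L2)

lemma axiom_Loeb: "normal_extension T \<Longrightarrow> \<box> (\<box> A \<^bold>\<rightarrow> A) \<^bold>\<rightarrow> \<box> A \<in> T"
  by (rule ILM_subset) (simp_all add: ILM_def ILX.L3)

lemma box_mono:
  assumes "normal_extension T" "A \<^bold>\<rightarrow> B \<in> T"
  shows "\<box> A \<^bold>\<rightarrow> \<box> B \<in> T"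
  by (rule mp[OF assms(1) axiom_K[OF assms(1)] nec[OF assms]])

lemma Loeb_rule:
  assumes "normal_extension T" "\<box> A \<^bold>\<rightarrow> A \<in> T"
  shows "A \<in> T"
  by (rule mp[OF assms(1) assms(2) mp[OF assms(1) axiom_Loeb[OF assms(1)] nec[OF assms]]])

text \<open>
  By transitivity a box on the left may be used twice: the worlds above satisfy both
  \<open>D\<close> and \<open>\<box> D\<close>.
\<close>

lemma box_mono_trans:
  assumes T: "normal_extension T" and DE: "D \<^bold>\<rightarrow> \<box> D \<^bold>\<rightarrow> E \<in> T"
  shows "\<box> D \<^bold>\<rightarrow> \<box> E \<in> T"
proof (rule prop_consequence3[OF T])
  show "\<box> D \<^bold>\<rightarrow> \<box> (\<box> D \<^bold>\<rightarrow> E) \<in> T" by (rule box_mono[OF T DE])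
  show "\<box> (\<box> D \<^bold>\<rightarrow> E) \<^bold>\<rightarrow> (\<box> \<box> D \<^bold>\<rightarrow> \<box> E) \<in> T" by (rule axiom_K[OF T])
  show "\<box> D \<^bold>\<rightarrow> \<box> \<box> D \<in> T" by (rule axiom_4[OF T])
qed (auto simp: tautology_def)

section \<open>Truth at a new root\<close>

text \<open>
  The relation \<open>A \<^bold>\<rightarrow> B \<^bold>\<or> \<diamond> B \<in> T\<close> between \<open>A\<close> and \<open>B\<close> is the meaning of \<open>\<rhd>\<close> at the root. This
  lemma and the next are J2 and M for it. Here the point is that a \<open>B\<close>-world above a given one
  only leads to \<open>C\<close>-worlds that the given one sees as well.
\<close>

lemma reach_trans:
  assumes T: "normal_extension T"
    and AB: "A \<^bold>\<rightarrow> B \<^bold>\<or> \<diamond> B \<in> T" and BC: "B \<^bold>\<rightarrow> C \<^bold>\<or> \<diamond> C \<in> T"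
  shows "A \<^bold>\<rightarrow> C \<^bold>\<or> \<diamond> C \<in> T"
proof -
  have "\<^bold>\<not> C \<^bold>\<rightarrow> \<box> \<^bold>\<not> C \<^bold>\<rightarrow> \<^bold>\<not> B \<in> T"
    by (rule prop_consequence1[OF T BC]) (auto simp: tautology_def)
  then have "\<box> \<^bold>\<not> C \<^bold>\<rightarrow> \<box> \<^bold>\<not> B \<in> T" by (rule box_mono_trans[OF T])
  from this AB BC show ?thesis
    by (rule prop_consequence3[OF T]) (auto simp: tautology_def)
qed

text \<open>A world above a world with \<open>\<box> C\<close> again satisfies \<open>\<box> C\<close>, so a \<open>B\<close>-world found there is
  a \<open>B \<^bold>\<and> \<box> C\<close>-world.\<close>

lemma reach_Montagna:
  assumes T: "normal_extension T" and AB: "A \<^bold>\<rightarrow> B \<^bold>\<or> \<diamond> B \<in> T"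
  shows "A \<^bold>\<and> \<box> C \<^bold>\<rightarrow> (B \<^bold>\<and> \<box> C) \<^bold>\<or> \<diamond> (B \<^bold>\<and> \<box> C) \<in> T"
proof -
  let ?N = "\<^bold>\<not> (B \<^bold>\<and> \<box> C)"
  have "\<box> C \<^bold>\<rightarrow> (?N \<^bold>\<rightarrow> \<^bold>\<not> B) \<in> T"
    by (rule prop_consequence0[OF T]) (auto simp: tautology_def)
  then have "\<box> \<box> C \<^bold>\<rightarrow> \<box> (?N \<^bold>\<rightarrow> \<^bold>\<not> B) \<in> T" by (rule box_mono[OF T])
  from axiom_4[OF T, of C] this axiom_K[OF T, of ?N "\<^bold>\<not> B"]
  have "\<box> C \<^bold>\<rightarrow> (\<box> ?N \<^bold>\<rightarrow> \<box> \<^bold>\<not> B) \<in> T"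
    by (rule prop_consequence3[OF T]) (auto simp: tautology_def)
  from this AB show ?thesis
    by (rule prop_consequence2[OF T]) (auto simp: tautology_def)
qed

text \<open>The last clause makes all variables false at the root and fixes default values for
  \<open>\<^bold>\<bottom>\<close> and implications.\<close>

fun root_val :: "'p form set \<Rightarrow> 'p form \<Rightarrow> bool"
  where
    "root_val T (\<box> A) \<longleftrightarrow> A \<in> T"
  | "root_val T (A \<rhd> B) \<longleftrightarrow> A \<^bold>\<rightarrow> B \<^bold>\<or> \<diamond> B \<in> T"
  | "root_val T _ \<longleftrightarrow> False"

abbreviation true_at_root :: "'p form set \<Rightarrow> 'p form \<Rightarrow> bool"
  where "true_at_root T \<equiv> prop_eval (root_val T)"

text \<open>
  Each axiom, read at the root, becomes a closure property of \<open>T\<close>. Necessitation is sound because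
  the root looks only at \<open>T\<close>, which contains the premise as a theorem of \<open>ILM\<close>.
\<close>

lemma root_soundness:
  assumes T: "normal_extension T" and "A \<in> ILM"
  shows "true_at_root T A"
  using \<open>A \<in> ILM\<close> unfolding ILM_def
proof (induction rule: ILX.induct)
  case (Taut A)
  then show ?case by (auto simp: tautology_def)
next
  case (L1 A B)
  then show ?case by (simp) (blast intro: mp[OF T])
next
  case (L2 A)
  then show ?case by (simp add: nec[OF T])
next
  case (L3 A)
  then show ?case by simp (blast intro: Loeb_rule[OF T, of A])
next
  case (J1 A B)
  have "A \<^bold>\<rightarrow> B \<^bold>\<or> \<diamond> B \<in> T" if "A \<^bold>\<rightarrow> B \<in> T"
    by (rule prop_consequence1[OF T that]) (auto simp: tautology_def)
  then show ?case by simp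
next
  case (J2 A B C)
  then show ?case by simp (blast intro: reach_trans[OF T, of A B C])
next
  case (J3 A C B)
  have "A \<^bold>\<or> B \<^bold>\<rightarrow> C \<^bold>\<or> \<diamond> C \<in> T" if "A \<^bold>\<rightarrow> C \<^bold>\<or> \<diamond> C \<in> T" "B \<^bold>\<rightarrow> C \<^bold>\<or> \<diamond> C \<in> T"
    by (rule prop_consequence2[OF T that]) (auto simp: tautology_def)
  then show ?case by simp
next
  case (J4 A B)
  have "\<^bold>\<not> A \<in> T" if AB: "A \<^bold>\<rightarrow> B \<^bold>\<or> \<diamond> B \<in> T" and B: "\<^bold>\<not> B \<in> T"
    by (rule prop_consequence3[OF T AB B nec[OF T B]]) (auto simp: tautology_def)
  then show ?case by auto
next
  case (J5 A)
  have "\<diamond> A \<^bold>\<rightarrow> A \<^bold>\<or> \<diamond> A \<in> T"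
    by (rule prop_consequence0[OF T]) (auto simp: tautology_def)
  then show ?case by simp
next
  case (Extra A)
  then show ?case
    unfolding M_axioms_def by clarsimp (blast dest: reach_Montagna[OF T])
next
  case (MP A B)
  then show ?case by simp
next
  case (Nec A)
  then show ?case using ILM_subset[OF T] by (simp add: ILM_def)
qed

text \<open>These are the formulas true in the part of the canonical picture that \<open>D \<^bold>\<and> \<box> D\<close> cuts out;
  that part is closed under successors, hence Necessitation.\<close>

lemma normal_extension_relativized:
  "normal_extension {E. D \<^bold>\<rightarrow> \<box> D \<^bold>\<rightarrow> E \<in> ILM}"
proof -
  note ILM = normal_extension_ILM
  have "D \<^bold>\<rightarrow> \<box> D \<^bold>\<rightarrow> E \<in> ILM" if "E \<in> ILM" for E
    by (rule prop_consequence1[OF ILM that]) (auto simp: tautology_def)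
  moreover have "D \<^bold>\<rightarrow> \<box> D \<^bold>\<rightarrow> F \<in> ILM"
    if "D \<^bold>\<rightarrow> \<box> D \<^bold>\<rightarrow> E \<^bold>\<rightarrow> F \<in> ILM" "D \<^bold>\<rightarrow> \<box> D \<^bold>\<rightarrow> E \<in> ILM" for E F
    by (rule prop_consequence2[OF ILM that]) (auto simp: tautology_def)
  moreover have "D \<^bold>\<rightarrow> \<box> D \<^bold>\<rightarrow> \<box> E \<in> ILM" if "D \<^bold>\<rightarrow> \<box> D \<^bold>\<rightarrow> E \<in> ILM" for E
    by (rule prop_consequence1[OF ILM box_mono_trans[OF ILM that]]) (auto simp: tautology_def)
  ultimately show ?thesis unfolding normal_extension_def by blast
qed

section \<open>Provability of boxes and of interpretability formulas\<close>

text \<open>Both \<open>B\<close> and \<open>\<diamond> B\<close> interpret \<open>B\<close>, the second by J5, hence so does \<open>B \<^bold>\<or> \<diamond> B\<close>.\<close>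

lemma rhd_intro:
  assumes "A \<^bold>\<rightarrow> B \<^bold>\<or> \<diamond> B \<in> ILM"
  shows "A \<rhd> B \<in> ILM"
proof -
  note ILM = normal_extension_ILM
  have J1: "C \<rhd> E \<in> ILM" if "C \<^bold>\<rightarrow> E \<in> ILM" for C E :: "'a form"
    using that unfolding ILM_def by (rule ILX.MP[OF ILX.J1 ILX.Nec])
  have "B \<^bold>\<rightarrow> B \<in> ILM"
    by (rule prop_consequence0[OF ILM]) (auto simp: tautology_def)
  then have "B \<rhd> B \<in> ILM" by (rule J1)
  moreover have "\<diamond> B \<rhd> B \<in> ILM" unfolding ILM_def by (rule ILX.J5)
  moreover have "(B \<rhd> B) \<^bold>\<and> (\<diamond> B \<rhd> B) \<^bold>\<rightarrow> B \<^bold>\<or> \<diamond> B \<rhd> B \<in> ILM" unfolding ILM_def by (rule ILX.J3)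
  ultimately have "B \<^bold>\<or> \<diamond> B \<rhd> B \<in> ILM"
    by (rule prop_consequence3[OF ILM]) (auto simp: tautology_def)
  with J1[OF assms] show ?thesis
  proof (rule prop_consequence3[OF ILM])
    show "(A \<rhd> B \<^bold>\<or> \<diamond> B) \<^bold>\<and> (B \<^bold>\<or> \<diamond> B \<rhd> B) \<^bold>\<rightarrow> A \<rhd> B \<in> ILM"
      unfolding ILM_def by (rule ILX.J2)
  qed (auto simp: tautology_def)
qed

lemma rhd_iff: "A \<rhd> B \<in> ILM \<longleftrightarrow> A \<^bold>\<rightarrow> B \<^bold>\<or> \<diamond> B \<in> ILM"
  using root_soundness[OF normal_extension_ILM, of "A \<rhd> B"] rhd_intro[of A B] by auto

lemma box_iff: "\<box> A \<in> ILM \<longleftrightarrow> A \<in> ILM"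
  using root_soundness[OF normal_extension_ILM, of "\<box> A"] nec[OF normal_extension_ILM] by auto

lemma box_disjunction_property: "\<box> A \<^bold>\<or> \<box> B \<in> ILM \<longleftrightarrow> \<box> A \<in> ILM \<or> \<box> B \<in> ILM"
proof
  assume "\<box> A \<^bold>\<or> \<box> B \<in> ILM"
  from root_soundness[OF normal_extension_ILM this]
  show "\<box> A \<in> ILM \<or> \<box> B \<in> ILM" by (auto simp: box_iff)
next
  have "\<box> A \<^bold>\<or> \<box> B \<in> ILM" if "\<box> A \<in> ILM"
    by (rule prop_consequence1[OF normal_extension_ILM that]) (auto simp: tautology_def)
  moreover have "\<box> A \<^bold>\<or> \<box> B \<in> ILM" if "\<box> B \<in> ILM"
    by (rule prop_consequence1[OF normal_extension_ILM that]) (auto simp: tautology_def)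
  moreover assume "\<box> A \<in> ILM \<or> \<box> B \<in> ILM"
  ultimately show "\<box> A \<^bold>\<or> \<box> B \<in> ILM" by blast
qed

text \<open>If \<open>A \<^bold>\<rightarrow> B \<^bold>\<or> \<diamond> B\<close> were not provable, a root below the worlds where \<open>\<^bold>\<not> B \<^bold>\<and> \<box> \<^bold>\<not> B\<close> holds
  would see an \<open>A\<close>-world and no \<open>B\<close>-world.\<close>

lemma rhd_iff_dia: "A \<rhd> B \<in> ILM \<longleftrightarrow> \<diamond> A \<^bold>\<rightarrow> \<diamond> B \<in> ILM"
proof
  assume "A \<rhd> B \<in> ILM"
  then show "\<diamond> A \<^bold>\<rightarrow> \<diamond> B \<in> ILM" unfolding ILM_def by (rule ILX.MP[OF ILX.J4])
next
  let ?T = "{E. \<^bold>\<not> B \<^bold>\<rightarrow> \<box> \<^bold>\<not> B \<^bold>\<rightarrow> E \<in> ILM}"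
  assume "\<diamond> A \<^bold>\<rightarrow> \<diamond> B \<in> ILM"
  then have "true_at_root ?T (\<diamond> A \<^bold>\<rightarrow> \<diamond> B)"
    by (rule root_soundness[OF normal_extension_relativized])
  moreover have "\<^bold>\<not> B \<^bold>\<rightarrow> \<box> \<^bold>\<not> B \<^bold>\<rightarrow> \<^bold>\<not> B \<in> ILM"
    by (rule prop_consequence0[OF normal_extension_ILM]) (auto simp: tautology_def)
  ultimately have "\<^bold>\<not> B \<^bold>\<rightarrow> \<box> \<^bold>\<not> B \<^bold>\<rightarrow> \<^bold>\<not> A \<in> ILM" by simp
  then have "A \<^bold>\<rightarrow> B \<^bold>\<or> \<diamond> B \<in> ILM"
    by (rule prop_consequence1[OF normal_extension_ILM]) (auto simp: tautology_def)
  then show "A \<rhd> B \<in> ILM" by (rule rhd_intro)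
qed

lemma prop_eval_Conj: "prop_eval v (Conj As) \<longleftrightarrow> (\<forall>A \<in> set As. prop_eval v A)"
  by (induction As) auto

text \<open>The root sees a world for every consistent formula, so it satisfies all the diamonds at
  once.\<close>

lemma drop_consistent_diamonds:
  assumes consistent: "\<forall>i < length As. \<^bold>\<not> (As ! i) \<notin> ILM"
  shows "Conj (map Dia As) \<^bold>\<rightarrow> A \<rhd> B \<in> ILM \<longleftrightarrow> A \<rhd> B \<in> ILM"
proof
  assume "Conj (map Dia As) \<^bold>\<rightarrow> A \<rhd> B \<in> ILM"
  then have "true_at_root ILM (Conj (map Dia As) \<^bold>\<rightarrow> A \<rhd> B)"
    by (rule root_soundness[OF normal_extension_ILM])
  moreover have "true_at_root ILM (Conj (map Dia As))"
    using consistent by (auto simp: prop_eval_Conj in_set_conv_nth)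
  ultimately show "A \<rhd> B \<in> ILM" by (simp add: rhd_iff)
next
  assume "A \<rhd> B \<in> ILM"
  then show "Conj (map Dia As) \<^bold>\<rightarrow> A \<rhd> B \<in> ILM"
    by (rule prop_consequence1[OF normal_extension_ILM]) (auto simp: tautology_def)
qed

text \<open>
  By Loeb's axiom every world is terminal or sees a terminal world, and in terminal worlds
  \<open>\<diamond> A\<close> is false. So requiring \<open>A \<^bold>\<or> \<diamond> A\<close> everywhere amounts to requiring \<open>A\<close> in the terminal
  worlds.
\<close>

lemma or_dia_iff: "A \<^bold>\<or> \<diamond> A \<in> ILM \<longleftrightarrow> \<box> \<^bold>\<bottom> \<^bold>\<rightarrow> A \<in> ILM"
proof
  note ILM = normal_extension_ILM
  assume A: "A \<^bold>\<or> \<diamond> A \<in> ILM"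
  have "\<^bold>\<bottom> \<^bold>\<rightarrow> \<^bold>\<not> A \<in> ILM"
    by (rule prop_consequence0[OF ILM]) (auto simp: tautology_def)
  then have "\<box> \<^bold>\<bottom> \<^bold>\<rightarrow> \<box> \<^bold>\<not> A \<in> ILM" by (rule box_mono[OF ILM])
  from this A show "\<box> \<^bold>\<bottom> \<^bold>\<rightarrow> A \<in> ILM"
    by (rule prop_consequence2[OF ILM]) (auto simp: tautology_def)
next
  note ILM = normal_extension_ILM
  assume A: "\<box> \<^bold>\<bottom> \<^bold>\<rightarrow> A \<in> ILM"
  then have "\<^bold>\<not> A \<^bold>\<rightarrow> (\<box> \<^bold>\<bottom> \<^bold>\<rightarrow> \<^bold>\<bottom>) \<in> ILM"
    by (rule prop_consequence1[OF ILM]) (auto simp: tautology_def)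
  then have "\<box> \<^bold>\<not> A \<^bold>\<rightarrow> \<box> (\<box> \<^bold>\<bottom> \<^bold>\<rightarrow> \<^bold>\<bottom>) \<in> ILM" by (rule box_mono[OF ILM])
  from this axiom_Loeb[OF ILM] A show "A \<^bold>\<or> \<diamond> A \<in> ILM"
    by (rule prop_consequence3[OF ILM]) (auto simp: tautology_def)
qed

lemma top_rhd_iff: "\<^bold>\<top> \<rhd> A \<in> ILM \<longleftrightarrow> \<box> \<^bold>\<bottom> \<^bold>\<rightarrow> A \<in> ILM"
proof -
  note ILM = normal_extension_ILM
  have "\<^bold>\<top> \<^bold>\<rightarrow> A \<^bold>\<or> \<diamond> A \<in> ILM \<longleftrightarrow> A \<^bold>\<or> \<diamond> A \<in> ILM"
  proof
    assume "\<^bold>\<top> \<^bold>\<rightarrow> A \<^bold>\<or> \<diamond> A \<in> ILM"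
    then show "A \<^bold>\<or> \<diamond> A \<in> ILM"
      by (rule prop_consequence1[OF ILM]) (auto simp: tautology_def)
  next
    assume "A \<^bold>\<or> \<diamond> A \<in> ILM"
    then show "\<^bold>\<top> \<^bold>\<rightarrow> A \<^bold>\<or> \<diamond> A \<in> ILM"
      by (rule prop_consequence1[OF ILM]) (auto simp: tautology_def)
  qed
  then show ?thesis by (simp only: rhd_iff or_dia_iff)
qed

theorem lemma3p10:
  fixes A B :: "'p::countable form"
  shows
    "(\<box> A \<in> ILM \<longleftrightarrow> A \<in> ILM) \<and>
     (\<box> A \<^bold>\<or> \<box> B \<in> ILM \<longleftrightarrow> \<box> A \<in> ILM \<or> \<box> B \<in> ILM) \<and>
     (A \<rhd> B \<in> ILM \<longleftrightarrow> A \<^bold>\<rightarrow> B \<^bold>\<or> \<diamond> B \<in> ILM) \<and>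
     (A \<rhd> B \<in> ILM \<longleftrightarrow> \<diamond> A \<^bold>\<rightarrow> \<diamond> B \<in> ILM) \<and>
     (\<forall>As :: 'p form list. (\<forall>i < length As. \<^bold>\<not> (As ! i) \<notin> ILM) \<longrightarrow>
        (Conj (map Dia As) \<^bold>\<rightarrow> A \<rhd> B \<in> ILM \<longleftrightarrow> A \<rhd> B \<in> ILM)) \<and>
     (A \<^bold>\<or> \<diamond> A \<in> ILM \<longleftrightarrow> \<box> \<^bold>\<bottom> \<^bold>\<rightarrow> A \<in> ILM) \<and>
     (\<^bold>\<top> \<rhd> A \<in> ILM \<longleftrightarrow> \<box> \<^bold>\<bottom> \<^bold>\<rightarrow> A \<in> ILM)"
  using box_iff box_disjunction_property rhd_iff rhd_iff_dia drop_consistent_diamonds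
    or_dia_iff top_rhd_iff by (intro conjI allI impI)

end
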